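(* Let $G=(N,A,\mathbf c)$ be a directed acyclic graph with source $s$ and destination $f$, let $\mathcal L$ be the list of auxiliary distributional constraints, and let $j,\ell\in\{1,\dots,2^{|\mathcal L|}\}$ with $j\neq \ell$. Let $\mathbf y_j,\mathbf y_\ell\in Y$ be the user's decisions under the response vectors $\mathbf r_j$ and $\mathbf r_\ell$, inducing the $s$–$f$ paths $P_j$ and $P_\ell$. Suppose that for each node $i\in N\setminus N_{j,\ell}$ the following constraints hold: (a) if all nodes in $N_{j,\ell}$ are reachable from $i$ in $G$, then $$y_{j,a}=y_{\ell,a}\qquad \forall a\in FS_i;$$ (b) otherwise, with $\widetilde N_{j,\ell}\subseteq N_{j,\ell}$ denoting the (nonempty) subset of nodes of $N_{j,\ell}$ that are not reachable from $i$, $$|y_{j,a}-y_{\ell,a}|\le \sum_{n\in\widetilde N_{j,\ell}}\ \sum_{a'\in FS_n} y_{j,a'}\qquad \forall a\in FS_i .$$ Then these constraints ensure non-anticipativity for the pair $(j,\ell)$: $P_j$ and $P_\ell$ coincide until a node of $N_{j,\ell}$ is reached.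
   Context: **Graph.** $G=(N,A,\mathbf c)$ is a weighted connected directed graph with finite node set $N$, directed arc set $A$ and random nonnegative cost vector $\mathbf c=(c_a)_{a\in A}$; $s\neq f$ are fixed source and destination nodes. $FS_i$ is the set of arcs directed out of node $i$ and $RS_i$ the set of arcs directed into node $i$. **Paths.** $Y\subseteq\{0,1\}^{|A|}$ is the set of incidence vectors of $s$–$f$ paths in which each node is visited at most once. It is described by $\sum_{a\in FS_i}y_a-\sum_{a\in RS_i}y_a = 1$ if $i=s$, $=-1$ if $i=f$, $=0$ otherwise, and $\sum_{a\in FS_i}y_a\le 1$, for all $i\in N$. **Auxiliary constraints and responses.** $\mathcal L$ is a finite list of distributional constraints. Each is associated with a node $i\in N\setminus\{f\}$ and involves only arcs in $FS_i$. It has one of the following two forms, where $\mathbb Q$ is the distribution of $\mathbf c$ and $\mathbb Q_a$ its marginal: - $\mathbb Q_a\{c_a\in[\widetilde l_a,\widetilde u_a]\}\le\widetilde q_a$ for some $a\in FS_i$; - $\mathbb E_{\mathbb Q}\{\sum_{a\in FS_i}p_ac_a\}\le p_0$. The attacker answers each constraint by "satisfied" (1) or "not satisfied" (0). Let $\mathbf r_1,\dots,\mathbf r_{2^{|\mathcal L|}}$ enumerate all vectors of $\{0,1\}^{|\mathcal L|}$, where $r_{jm}$ is the response to the $m$-th constraint in scenario $j$. The user selects one path $\mathbf y_j\in Y$ for each scenario $j$. The user learns the responses to the constraints associated with node $i$ only upon reaching node $i$. **Distinguishing nodes.** $N_{j,\ell}\subseteq N\setminus\{f\}$ is the set of nodes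 $i$ for which some constraint in $\mathcal L$ associated with $i$, say the $m$-th, satisfies $r_{jm}\ne r_{\ell m}$. **Non-anticipativity.** The paths must coincide as long as the user cannot distinguish scenario $j$ from scenario $\ell$. Precisely, the pair $(\mathbf y_j,\mathbf y_\ell)$ is non-anticipative if the following holds. If $P_j$ contains no node of $N_{j,\ell}$, then $P_j=P_\ell$. Otherwise, if $n$ is the first node of $P_j$ lying in $N_{j,\ell}$, then $P_\ell$ also contains $n$, and the initial segments of $P_j$ and $P_\ell$ from $s$ up to $n$ are identical (the arcs chosen at $n$ may differ). *)

theory Defs
  imports "HOL-Probability.Probability_Measure" "Graph_Theory.Digraph_Component"
begin

text \<open>
  Both auxiliary constraint forms carry the node they are associated with as first argument.
  \<open>Interval_Constraint i a l u q\<close> stands for \<open>Q\<^sub>a{c\<^sub>a \<in> [l, u]} \<le> q\<close>, and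
  \<open>Mean_Constraint i p p0\<close> for \<open>E\<^sub>Q(\<Sum>a \<in> FS\<^sub>i. p\<^sub>a * c\<^sub>a) \<le> p0\<close>.  Throughout, \<open>FS\<^sub>i\<close> is
  \<open>out_arcs G i\<close> and \<open>RS\<^sub>i\<close> is \<open>in_arcs G i\<close>.
\<close>

datatype ('v, 'a) aux_constraint =
    Interval_Constraint (node_of: 'v) 'a real real real
  | Mean_Constraint (node_of: 'v) "'a \<Rightarrow> real" real

fun wf_constraint :: "('v, 'a) pre_digraph \<Rightarrow> 'v \<Rightarrow> ('v, 'a) aux_constraint \<Rightarrow> bool" where
  "wf_constraint G f (Interval_Constraint i a l u q) \<longleftrightarrow> i \<in> verts G - {f} \<and> a \<in> out_arcs G i"
| "wf_constraint G f (Mean_Constraint i p p0) \<longleftrightarrow> i \<in> verts G - {f}"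

text \<open>
  The meaning of a constraint under a cost distribution; a mean constraint whose expectation does
  not exist as a real number counts as not satisfied.  The scenarios below range over all
  response vectors, whether or not some distribution gives rise to them.
\<close>

fun satisfied ::
  "('v, 'a) pre_digraph \<Rightarrow> ('a \<Rightarrow> real) measure \<Rightarrow> ('v, 'a) aux_constraint \<Rightarrow> bool" where
  "satisfied G Q (Interval_Constraint i a l u q) \<longleftrightarrow>
     measure (distr Q borel (\<lambda>c. c a)) {l..u} \<le> q"
| "satisfied G Q (Mean_Constraint i p p0) \<longleftrightarrow>
     integrable Q (\<lambda>c. \<Sum>a\<in>out_arcs G i. p a * c a) \<and>
     (\<integral>c. (\<Sum>a\<in>out_arcs G i. p a * c a) \<partial>Q) \<le> p0"

text \<open>
  \<open>Q\<close> is the joint distribution of the cost vector.  Connectedness is that of the underlying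
  undirected graph.  The function \<open>r\<close> enumerates all response vectors; scenarios are numbered
  from 1, the positions of the list \<open>L\<close> from 0.
\<close>

locale path_problem = fin_digraph G + Q: prob_space Q
  for G :: "('v, 'a) pre_digraph" (structure) and Q :: "('a \<Rightarrow> real) measure" +
  fixes s f :: 'v
    and L :: "('v, 'a) aux_constraint list"
    and r :: "nat \<Rightarrow> nat \<Rightarrow> nat"
  assumes connected: "Digraph_Component.connected G"
    and sets_Q: "sets Q = sets (PiM (arcs G) (\<lambda>_. borel))"
    and cost_nonneg: "AE c in Q. \<forall>a\<in>arcs G. 0 \<le> c a"
    and source: "s \<in> verts G" and destination: "f \<in> verts G" and s_neq_f: "s \<noteq> f"
    and constraints: "\<forall>con\<in>set L. wf_constraint G f con"
    and responses: "bij_betw r {1..2 ^ length L} ({..<length L} \<rightarrow>\<^sub>E {0, 1})"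

definition acyclic_digraph :: "('v, 'a) pre_digraph \<Rightarrow> bool" where
  "acyclic_digraph G \<longleftrightarrow> (\<nexists>p. pre_digraph.cycle G p)"

definition incidence :: "('v, 'a) pre_digraph \<Rightarrow> 'a awalk \<Rightarrow> 'a \<Rightarrow> real" where
  "incidence G p = (\<lambda>a\<in>arcs G. if a \<in> set p then 1 else 0)"

definition induces :: "('v, 'a) pre_digraph \<Rightarrow> 'v \<Rightarrow> 'v \<Rightarrow> ('a \<Rightarrow> real) \<Rightarrow> 'a awalk \<Rightarrow> bool" where
  "induces G s f y p \<longleftrightarrow> pre_digraph.apath G s p f \<and> y = incidence G p"

definition path_vectors :: "('v, 'a) pre_digraph \<Rightarrow> 'v \<Rightarrow> 'v \<Rightarrow> ('a \<Rightarrow> real) set" where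
  "path_vectors G s f = {y. \<exists>p. induces G s f y p}"

definition distinguishing_nodes ::
  "('v, 'a) pre_digraph \<Rightarrow> 'v \<Rightarrow> ('v, 'a) aux_constraint list \<Rightarrow> (nat \<Rightarrow> nat \<Rightarrow> nat) \<Rightarrow>
     nat \<Rightarrow> nat \<Rightarrow> 'v set" where
  "distinguishing_nodes G f L r j l =
     {i \<in> verts G - {f}. \<exists>m<length L. node_of (L ! m) = i \<and> r j m \<noteq> r l m}"

text \<open>The part of a path up to its first visit of \<open>n\<close>; all of it if \<open>n\<close> is its last node.\<close>

definition initial_segment :: "('v, 'a) pre_digraph \<Rightarrow> 'v \<Rightarrow> 'a awalk \<Rightarrow> 'a awalk" where
  "initial_segment G n p = takeWhile (\<lambda>a. tail G a \<noteq> n) p"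

definition non_anticipative ::
  "('v, 'a) pre_digraph \<Rightarrow> 'v \<Rightarrow> 'v set \<Rightarrow> 'a awalk \<Rightarrow> 'a awalk \<Rightarrow> bool" where
  "non_anticipative G s D p q \<longleftrightarrow>
     (case find (\<lambda>v. v \<in> D) (pre_digraph.awalk_verts G s p) of
        None \<Rightarrow> p = q
      | Some n \<Rightarrow> n \<in> set (pre_digraph.awalk_verts G s q) \<and>
                  initial_segment G n p = initial_segment G n q)"

subsection \<open>Linear description of the path vectors\<close>

lemma (in fin_digraph) acyclic_awalk_apath:
  assumes "acyclic_digraph G" "awalk u p v"
  shows "apath u p v"
proof (rule ccontr)
  assume "\<not> apath u p v"
  then have "\<not> distinct (awalk_verts u p)" using assms(2) by (simp add: apath_def)
  from awalk_not_distinct_decomp[OF assms(2) this] obtain q where "closed_w q"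
    by (auto simp: closed_w_def)
  then show False using closed_w_imp_cycle assms(1) by (auto simp: acyclic_digraph_def)
qed

lemma (in fin_digraph) maximal_awalk:
  assumes ac: "acyclic_digraph G" and W: "W \<subseteq> arcs G" "a0 \<in> W"
  obtains p v where "awalk (tail G a0) p v" "p \<noteq> []" "set p \<subseteq> W" "\<forall>a\<in>W. tail G a \<noteq> v"
proof -
  define P where "P p \<longleftrightarrow> (\<exists>v. awalk (tail G a0) p v) \<and> p \<noteq> [] \<and> set p \<subseteq> W" for p
  have "P [a0]" using W arc_implies_awalk[of a0] by (auto simp: P_def)
  moreover have "\<forall>p. P p \<longrightarrow> length p < card (verts G)"
    unfolding P_def using acyclic_awalk_apath[OF ac] length_apath_less by blast
  ultimately obtain p where p: "P p" "\<forall>q. P q \<longrightarrow> length q \<le> length p"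
    using ex_has_greatest_nat[of P "[a0]" length "card (verts G)"] by blast
  then obtain v where v: "awalk (tail G a0) p v" by (auto simp: P_def)
  have "tail G a \<noteq> v" if "a \<in> W" for a
  proof
    assume "tail G a = v"
    then have "awalk v [a] (head G a)" using that W arc_implies_awalk[of a] by auto
    then have "P (p @ [a])" using awalk_appendI[OF v] p(1) that by (auto simp: P_def)
    then show False using p(2) by fastforce
  qed
  then show ?thesis using that v p(1) by (auto simp: P_def)
qed

lemma (in fin_digraph) sum_incidence:
  assumes "set p \<subseteq> arcs G" "distinct p" "S \<subseteq> arcs G"
  shows "(\<Sum>a\<in>S. incidence G p a) = real (length (filter (\<lambda>a. a \<in> S) p))"
proof -
  have fin: "finite S" using assms(3) finite_arcs finite_subset by blast
  have "(\<Sum>a\<in>S. incidence G p a) = (\<Sum>a\<in>S. if a \<in> set p then 1 else 0)"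
    using assms(3) by (intro sum.cong) (auto simp: incidence_def)
  also have "\<dots> = real (card (S \<inter> set p))" using fin by (simp add: sum.If_cases Int_def)
  also have "S \<inter> set p = set (filter (\<lambda>a. a \<in> S) p)" by auto
  finally show ?thesis using distinct_card[of "filter (\<lambda>a. a \<in> S) p"] assms(2) by simp
qed

lemma (in fin_digraph) filter_balance:
  assumes "awalk u p v"
  shows "real (length (filter (\<lambda>a. a \<in> out_arcs G i) p)) - real (length (filter (\<lambda>a. a \<in> in_arcs G i) p))
         = (if i = u then 1 else 0) - (if i = v then 1 else 0)"
  using assms
proof (induction p arbitrary: u)
  case Nil
  then show ?case by (auto simp: awalk_simps)
next
  case (Cons e p)
  then have e: "e \<in> arcs G" "u = tail G e" and p: "awalk (head G e) p v"
    by (auto simp: awalk_simps)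
  show ?case using Cons.IH[OF p] e by (auto split: if_splits)
qed

lemma (in fin_digraph) apath_incidence_flow:
  assumes p: "apath u p v"
  shows "(\<Sum>a\<in>out_arcs G i. incidence G p a) - (\<Sum>a\<in>in_arcs G i. incidence G p a)
         = (if i = u then 1 else 0) - (if i = v then 1 else 0)"
    and "(\<Sum>a\<in>out_arcs G i. incidence G p a) \<le> 1"
proof -
  have aw: "awalk u p v" and dv: "distinct (awalk_verts u p)" using p by (auto simp: apath_def)
  have d: "distinct p" using distinct_verts_imp_distinct[OF aw dv] .
  have sub: "set p \<subseteq> arcs G" using aw by auto
  have io: "out_arcs G i \<subseteq> arcs G" "in_arcs G i \<subseteq> arcs G" by auto
  show "(\<Sum>a\<in>out_arcs G i. incidence G p a) - (\<Sum>a\<in>in_arcs G i. incidence G p a)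
         = (if i = u then 1 else 0) - (if i = v then 1 else 0)"
    using filter_balance[OF aw] sum_incidence[OF sub d] io by simp
  have "distinct (map (tail G) p)" using dv by (auto simp: awalk_verts_conv split: if_splits)
  then have "inj_on (tail G) (set p)" by (simp add: distinct_map)
  then have "card (set (filter (\<lambda>a. a \<in> out_arcs G i) p)) \<le> 1"
    by (intro card_le_Suc0_iff_eq[THEN iffD2, THEN order_trans]) (auto dest: inj_onD)
  then show "(\<Sum>a\<in>out_arcs G i. incidence G p a) \<le> 1"
    using sum_incidence[OF sub d io(1)] distinct_card[of "filter (\<lambda>a. a \<in> out_arcs G i) p"] d
    by simp
qed

lemma (in fin_digraph) path_vectors_flow:
  assumes ac: "acyclic_digraph G" and s: "s \<in> verts G" and sf: "s \<noteq> f"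
  shows "path_vectors G s f =
    {y \<in> arcs G \<rightarrow>\<^sub>E {0, 1}. \<forall>i\<in>verts G.
       (\<Sum>a\<in>out_arcs G i. y a) - (\<Sum>a\<in>in_arcs G i. y a)
         = (if i = s then 1 else if i = f then -1 else 0) \<and>
       (\<Sum>a\<in>out_arcs G i. y a) \<le> 1}" (is "_ = ?F")
proof (intro equalityI subsetI)
  fix y assume "y \<in> path_vectors G s f"
  then obtain p where p: "apath s p f" "y = incidence G p"
    by (auto simp: path_vectors_def induces_def)
  show "y \<in> ?F"
    using apath_incidence_flow[OF p(1)] sf p(2) by (auto simp: incidence_def)
next
  fix y assume y: "y \<in> ?F"
  then have y01: "\<And>a. a \<in> arcs G \<Longrightarrow> y a = 0 \<or> y a = 1" by (auto simp: PiE_iff)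
  have ext: "y \<in> extensional (arcs G)" using y by (auto simp: PiE_iff)
  have bal: "(\<Sum>a\<in>out_arcs G i. y a) - (\<Sum>a\<in>in_arcs G i. y a)
         = (if i = s then 1 else if i = f then -1 else 0)" if "i \<in> verts G" for i
    using y that by auto
  have out_ex: "\<exists>a\<in>out_arcs G i. z a = 1"
    if "(\<Sum>a\<in>out_arcs G i. z a) > 0" "\<forall>a\<in>arcs G. z a = 0 \<or> z a = 1" for z :: "_ \<Rightarrow> real" and i
  proof (rule ccontr)
    assume "\<not> ?thesis"
    then have "(\<Sum>a\<in>out_arcs G i. z a) = 0" using that(2) by (intro sum.neutral) auto
    then show False using that(1) by simp
  qed
  have in_pos: "(\<Sum>a\<in>in_arcs G (head G e). z a) \<ge> 1"
    if "e \<in> arcs G" "z e = 1" "\<forall>a\<in>arcs G. z a = 0 \<or> z a = 1" for z :: "_ \<Rightarrow> real" and e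
  proof -
    have "z e \<le> (\<Sum>a\<in>in_arcs G (head G e). z a)"
      using that by (intro member_le_sum) force+
    then show ?thesis using that by simp
  qed
  have last_arc: "\<exists>e\<in>set p. head G e = v" if "awalk u p v" "p \<noteq> []" for u p v
    using that by (induction p arbitrary: u) (auto simp: awalk_simps, metis awalk_Nil_iff)
  have ins0: "0 \<le> (\<Sum>a\<in>in_arcs G i. y a)" for i using y01 by (intro sum_nonneg) force
  define W where "W = {a \<in> arcs G. y a = 1}"
  have "(\<Sum>a\<in>out_arcs G s. y a) > 0" using bal[OF s] ins0[of s] by simp
  then obtain a0 where a0: "a0 \<in> W" "tail G a0 = s"
    using out_ex[of y s] y01 by (auto simp: W_def)
  from maximal_awalk[OF ac _ a0(1)] a0(2) obtain p v where
    p: "awalk s p v" "p \<noteq> []" "set p \<subseteq> W" "\<forall>a\<in>W. tail G a \<noteq> v"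
    by (auto simp: W_def)
  have "v = f"
  proof (rule ccontr)
    assume "v \<noteq> f"
    obtain e where e: "e \<in> set p" "head G e = v" using last_arc p by blast
    then have "(\<Sum>a\<in>in_arcs G v. y a) \<ge> 1" using in_pos[of e y] p(3) y01 by (auto simp: W_def)
    moreover have "v \<in> verts G" using p(1) by auto
    ultimately have "(\<Sum>a\<in>out_arcs G v. y a) > 0"
      using bal[of v] \<open>v \<noteq> f\<close> by (auto split: if_splits)
    then show False using out_ex[of y v] y01 p(4) by (auto simp: W_def)
  qed
  then have ap: "apath s p f" using acyclic_awalk_apath[OF ac] p(1) by simp
  define z where "z a = y a - incidence G p a" for a
  have z01: "\<forall>a\<in>arcs G. z a = 0 \<or> z a = 1"
    using y01 p(3) by (auto simp: z_def incidence_def W_def)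
  have zbal: "(\<Sum>a\<in>out_arcs G i. z a) = (\<Sum>a\<in>in_arcs G i. z a)" if "i \<in> verts G" for i
    using bal[OF that] apath_incidence_flow(1)[OF ap, of i] sf
    by (simp add: z_def sum_subtractf split: if_splits)
  have z0: "z a = 0" if a: "a \<in> arcs G" for a
  proof (rule ccontr)
    assume "z a \<noteq> 0"
    define V where "V = {a \<in> arcs G. z a = 1}"
    have "a \<in> V" using z01 a \<open>z a \<noteq> 0\<close> by (auto simp: V_def)
    from maximal_awalk[OF ac _ this] obtain q w where
      q: "awalk (tail G a) q w" "q \<noteq> []" "set q \<subseteq> V" "\<forall>a\<in>V. tail G a \<noteq> w"
      by (auto simp: V_def)
    obtain e where e: "e \<in> set q" "head G e = w" using last_arc q by blast
    then have "(\<Sum>a\<in>in_arcs G w. z a) \<ge> 1" using in_pos[of e z] q(3) z01 by (auto simp: V_def)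
    then have "(\<Sum>a\<in>out_arcs G w. z a) > 0" using zbal[of w] q(1) by auto
    then show False using out_ex[of z w] z01 q(4) by (auto simp: V_def)
  qed
  have "y = incidence G p"
  proof
    fix a show "y a = incidence G p a"
      using z0[of a] ext by (cases "a \<in> arcs G") (auto simp: z_def incidence_def extensional_def)
  qed
  then show "y \<in> path_vectors G s f" using ap by (auto simp: path_vectors_def induces_def)
qed

end

(*
  At a node i of P_j before the first distinguishing node, P_j avoids every distinguishing node n
  that is not reachable from i: nodes of P_j after i are reachable from i, and nodes before i are not
  distinguishing.  So the right-hand side of (b) vanishes, and (a) and (b) alike force y_j and y_l
  to agree on the arcs out of i.  Hence P_l contains every arc of P_j up to the first
  distinguishing node, and since both are paths from s, they take these arcs in the same order.
*)
theory Submission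
  imports Defs
begin

text \<open>A path never returns to its start \<open>u\<close>, so no arc of \<open>q\<close> can
  leave \<open>u\<close>.\<close>

lemma (in wf_digraph) apath_tail_hd:
  assumes "apath u (e # q) v" "e' \<in> set (e # q)" "tail G e' = u"
  shows "e' = e"
proof (rule ccontr)
  assume "e' \<noteq> e"
  then have "e' \<in> set q" using assms(2) by simp
  moreover have "awalk (head G e) q v" "u \<notin> set (awalk_verts (head G e) q)"
    using assms(1) by (auto simp: apath_Cons_iff apath_def awalk_Cons_iff)
  ultimately show False using assms(3) by (auto simp: set_awalk_verts)
qed

text \<open>Reduces the order of arcs to plain membership. By induction on \<open>p\<close>: while
  the current node \<open>u\<close> is outside \<open>D\<close>, the first arc of \<open>p\<close>
  lies in \<open>q\<close> and leaves \<open>u\<close>, so it is also the first arc of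
  \<open>q\<close>; strip it from both.\<close>

lemma (in wf_digraph) non_anticipative_apath:
  assumes "apath u p v" "apath u q v" "v \<notin> D"
    and "set (takeWhile (\<lambda>a. tail G a \<notin> D) p) \<subseteq> set q"
  shows "non_anticipative G u D p q"
  using assms
proof (induction p arbitrary: u q)
  case Nil
  then have "u = v" by (simp add: apath_def awalk_Nil_iff)
  \<comment> \<open>A nonempty path has distinct ends.\<close>
  then have "q = []" using Nil.prems(2) using apath_nonempty_ends by blast
  then show ?case using Nil.prems(3) \<open>u = v\<close> by (simp add: non_anticipative_def)
next
  case (Cons e p)
  have e: "tail G e = u" "apath (head G e) p v" "u \<notin> set (awalk_verts (head G e) p)"
    using Cons.prems(1) by (auto simp: apath_Cons_iff)
  show ?case
  proof (cases "u \<in> D")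
    case True
    have "u \<in> set (awalk_verts u q)"
      using Cons.prems(2) by (auto simp: apath_def intro: hd_in_awalk_verts)
    \<comment> \<open>If \<open>q\<close> has a first arc, it leaves \<open>u\<close>, so
      \<open>takeWhile\<close> stops at once.\<close>
    moreover have "initial_segment G u q = []"
      using Cons.prems(2) by (cases q) (auto simp: initial_segment_def apath_Cons_iff)
    ultimately show ?thesis using True e(1)
      by (simp add: non_anticipative_def initial_segment_def)
  next
    case False
    then have eq: "e \<in> set q" using Cons.prems(4) e(1) by simp
    then obtain e' q' where q: "q = e' # q'" by (cases q) auto
    then have ee: "e' = e" using apath_tail_hd Cons.prems(2) eq e(1) by metis
    \<comment> \<open>Hence removing \<open>e\<close> from the front of \<open>q\<close> loses no
      arc that the inclusion for \<open>p\<close> needs.\<close>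
    have "e \<notin> set p" using e by (auto simp: apath_def set_awalk_verts)
    then have "set (takeWhile (\<lambda>a. tail G a \<notin> D) p) \<subseteq> set q'"
      using Cons.prems(4) False e(1) q ee by (auto dest: set_takeWhileD)
    moreover have "apath (head G e) q' v" using Cons.prems(2) q ee by (auto simp: apath_Cons_iff)
    ultimately have "non_anticipative G (head G e) D p q'"
      using Cons.IH e(2) Cons.prems(3) by blast
    \<comment> \<open>The first node of the remaining path in \<open>D\<close> differs from
      \<open>u\<close>, the tail of \<open>e\<close>, so putting \<open>e\<close> back extends both
      initial segments by \<open>e\<close>.\<close>
    moreover have "u \<noteq> n" if "find (\<lambda>v. v \<in> D) vs = Some n" for n vs
      using that False by (auto simp: find_Some_iff)
    ultimately show ?thesis using False e(1) q ee
      by (auto simp: non_anticipative_def initial_segment_def split: option.splits)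
  qed
qed

lemma (in wf_digraph) awalk_reachable_tail:
  assumes "awalk u (p @ a # p') v" "b \<in> set (a # p')"
  shows "tail G a \<rightarrow>\<^sup>* tail G b"
proof -
  have w: "awalk (tail G a) (a # p') v" using assms(1) by (auto simp: awalk_simps)
  then have "tail G b \<in> set (awalk_verts (tail G a) (a # p'))"
    using assms(2) by (subst set_awalk_verts[OF w]) auto
  then show ?thesis using awalk_verts_reachable_from[OF w] by blast
qed

theorem proposition1:
  fixes G :: "('v, 'a) pre_digraph"
    and Q :: "('a \<Rightarrow> real) measure"
    and s f :: 'v
    and L :: "('v, 'a) aux_constraint list"
    and r :: "nat \<Rightarrow> nat \<Rightarrow> nat"
    and y :: "nat \<Rightarrow> 'a \<Rightarrow> real"
    and P :: "nat \<Rightarrow> 'a awalk"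
    and j l :: nat
  assumes "path_problem G Q s f L r"
    and "acyclic_digraph G"
    and "j \<in> {1..2 ^ length L}" and "l \<in> {1..2 ^ length L}" and "j \<noteq> l"
    and "y j \<in> path_vectors G s f" and "y l \<in> path_vectors G s f"
    and "induces G s f (y j) (P j)" and "induces G s f (y l) (P l)"
    and constraint_a:
      "\<And>i. i \<in> verts G - distinguishing_nodes G f L r j l \<Longrightarrow>
         \<forall>n\<in>distinguishing_nodes G f L r j l. i \<rightarrow>\<^sup>*\<^bsub>G\<^esub> n \<Longrightarrow>
         \<forall>a\<in>out_arcs G i. y j a = y l a"
    and constraint_b:
      "\<And>i. i \<in> verts G - distinguishing_nodes G f L r j l \<Longrightarrow>
         \<not> (\<forall>n\<in>distinguishing_nodes G f L r j l. i \<rightarrow>\<^sup>*\<^bsub>G\<^esub> n) \<Longrightarrow>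
         \<forall>a\<in>out_arcs G i. \<bar>y j a - y l a\<bar>
           \<le> (\<Sum>n\<in>{n \<in> distinguishing_nodes G f L r j l. \<not> i \<rightarrow>\<^sup>*\<^bsub>G\<^esub> n}.
                \<Sum>a'\<in>out_arcs G n. y j a')"
  shows "non_anticipative G s (distinguishing_nodes G f L r j l) (P j) (P l)"
proof -
  interpret path_problem G Q s f L r by fact
  define D where "D = distinguishing_nodes G f L r j l"
  have Pj: "apath s (P j) f" "y j = incidence G (P j)"
    and Pl: "apath s (P l) f" "y l = incidence G (P l)"
    using assms(8,9) by (auto simp: induces_def)
  have wj: "awalk s (P j) f" using Pj(1) by (simp add: apath_def)
  have "a \<in> set (P l)" if a: "a \<in> set (takeWhile (\<lambda>a. tail G a \<notin> D) (P j))" for a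
  proof -
    \<comment> \<open>Split the whole path at \<open>a\<close>: tails of arcs in \<open>xs\<close>
      are outside \<open>D\<close>, and tails of arcs in \<open>ys @ zs\<close> are reachable from
      the tail of \<open>a\<close>.\<close>
    define zs where "zs = dropWhile (\<lambda>a. tail G a \<notin> D) (P j)"
    obtain xs ys where xy: "takeWhile (\<lambda>a. tail G a \<notin> D) (P j) = xs @ a # ys"
      using split_list[OF a] by blast
    have p: "P j = xs @ a # (ys @ zs)"
      using takeWhile_dropWhile_id[of "\<lambda>a. tail G a \<notin> D" "P j"]
      unfolding xy zs_def[symmetric] by simp
    have pre: "tail G b \<notin> D" if "b \<in> set (xs @ [a])" for b
      using that xy set_takeWhileD[of b "\<lambda>a. tail G a \<notin> D" "P j"] by auto
    have arc: "a \<in> arcs G" using wj p by auto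
    have iD: "tail G a \<in> verts G - D" using arc pre by auto
    have "y j a = y l a"
    \<comment> \<open>An empty \<open>D\<close> falls under (a) vacuously.\<close>
    proof (cases "\<forall>n\<in>D. tail G a \<rightarrow>\<^sup>*\<^bsub>G\<^esub> n")
      case True
      then show ?thesis using constraint_a[OF iD[unfolded D_def] True[unfolded D_def]] arc by simp
    next
      case False
      have "y j b = 0" if "n \<in> D" "\<not> tail G a \<rightarrow>\<^sup>*\<^bsub>G\<^esub> n" "b \<in> out_arcs G n" for n b
      proof -
        have "b \<notin> set (P j)"
        proof
          assume "b \<in> set (P j)"
          then consider "b \<in> set xs" | "b \<in> set (a # (ys @ zs))" unfolding p by auto
          then show False
          proof cases
            case 1
            then show False using pre[of b] that(1,3) by simp
          next
            case 2
            then show False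
              using awalk_reachable_tail[OF wj[unfolded p]] that(2,3) by auto
          qed
        qed
        then show ?thesis using that(3) Pj(2) by (simp add: incidence_def)
      qed
      then have "(\<Sum>n\<in>{n \<in> D. \<not> tail G a \<rightarrow>\<^sup>*\<^bsub>G\<^esub> n}. \<Sum>b\<in>out_arcs G n. y j b) = 0"
        by (auto intro!: sum.neutral)
      then show ?thesis using constraint_b[OF iD[unfolded D_def] False[unfolded D_def]] arc by (simp add: D_def)
    qed
    \<comment> \<open>Therefore \<open>y l a = 1\<close>, and an incidence vector takes the value 1
      only on arcs of its path.\<close>
    moreover have "y j a = 1" using arc p by (simp add: Pj(2) incidence_def)
    ultimately show ?thesis using arc by (simp add: Pl(2) incidence_def split: if_splits)
  qed
  moreover have "f \<notin> D" by (simp add: D_def distinguishing_nodes_def)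
  ultimately show ?thesis
    using non_anticipative_apath[OF Pj(1) Pl(1)] unfolding D_def by blast
qed

end
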